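(* For all positive integers $n$, $m$, and $h$ with $m\leq n$, we have $$\rho_{\pm}(\mathbb{Z}_n,m,h)=\rho(\mathbb{Z}_n,m,h).$$
   Context: $\mathbb{Z}_n$ is the cyclic group of order $n$, written additively. For an $m$-subset $A=\{a_1,\dots,a_m\}$ of a finite abelian group $G$ (with $m\ge 1$), the $h$-fold sumset and $h$-fold signed sumset are $$hA=\Big\{ \sum_{i=1}^m \lambda_i a_i : (\lambda_1,\dots,\lambda_m)\in\mathbb{N}_0^m,\ \sum_{i=1}^m\lambda_i=h\Big\},$$ $$h_{\pm}A=\Big\{ \sum_{i=1}^m \lambda_i a_i : (\lambda_1,\dots,\lambda_m)\in\mathbb{Z}^m,\ \sum_{i=1}^m|\lambda_i|=h\Big\},$$ where $\mathbb{N}_0$ is the set of nonnegative integers. For a positive integer $m\le|G|$, $$\rho(G,m,h)=\min\{|hA| : A\subseteq G,\ |A|=m\},\qquad \rho_{\pm}(G,m,h)=\min\{|h_{\pm}A| : A\subseteq G,\ |A|=m\}.$$ *)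

theory Defs
  imports "HOL-Algebra.Elementary_Groups" "HOL-Algebra.FiniteProduct"
begin

text \<open>
  Abelian groups are written multiplicatively, following HOL-Algebra, so an integer
  combination of the elements of \<open>A\<close> becomes a product of powers. The coefficient
  attached to \<open>a \<in> A\<close> is \<open>c a\<close>; values of \<open>c\<close> outside \<open>A\<close> are irrelevant.
\<close>

definition sumset :: "('a, 'b) monoid_scheme \<Rightarrow> nat \<Rightarrow> 'a set \<Rightarrow> 'a set" where
  "sumset G h A =
     {(\<Otimes>\<^bsub>G\<^esub>a\<in>A. a [^]\<^bsub>G\<^esub> c a) | c :: 'a \<Rightarrow> nat. (\<Sum>a\<in>A. c a) = h}"

definition signed_sumset :: "('a, 'b) monoid_scheme \<Rightarrow> nat \<Rightarrow> 'a set \<Rightarrow> 'a set" where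
  "signed_sumset G h A =
     {(\<Otimes>\<^bsub>G\<^esub>a\<in>A. a [^]\<^bsub>G\<^esub> c a) | c :: 'a \<Rightarrow> int. (\<Sum>a\<in>A. \<bar>c a\<bar>) = int h}"

text \<open>
  Both minima are meant for finite \<open>G\<close> and \<open>1 \<le> m \<le> order G\<close>; then they range over
  finite nonempty sets of naturals, so \<open>Min\<close> is well-defined.
\<close>

definition rho :: "('a, 'b) monoid_scheme \<Rightarrow> nat \<Rightarrow> nat \<Rightarrow> nat" where
  "rho G m h = Min {card (sumset G h A) | A. A \<subseteq> carrier G \<and> card A = m}"

definition rho_signed :: "('a, 'b) monoid_scheme \<Rightarrow> nat \<Rightarrow> nat \<Rightarrow> nat" where
  "rho_signed G m h = Min {card (signed_sumset G h A) | A. A \<subseteq> carrier G \<and> card A = m}"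

end

theory Submission
  imports Defs Complex_Main "HOL-Library.Set_Algebras"
begin

text \<open>
  Since \<open>hA\<close> is contained in \<open>h\<^sub>\<plusminus>A\<close>, only an upper bound on \<open>\<rho>\<^sub>\<plusminus>\<close> is at stake. Let
  \<open>|A| = m\<close>, let \<open>H\<close> be the stabilizer of \<open>hA\<close>, of order \<open>d\<close>, and let \<open>k\<close> be the number of
  cosets of \<open>H\<close> that meet \<open>A\<close>. Kneser's theorem gives \<open>|hA| \<ge> (h (k - 1) + 1) d\<close>, where
  \<open>m \<le> k d\<close>. Conversely, with \<open>N = n / d\<close>, one finds a symmetric set of \<open>k\<close> residues modulo
  \<open>N\<close> whose \<open>h\<close>-fold sumset has at most \<open>h (k - 1) + 1\<close> elements: a centred arithmetic
  progression with difference 1 or 2, or else an interval together with \<open>N / 2\<close>. An \<open>m\<close>-subset \<open>B\<close> of its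
  preimage in \<open>\<int>\<^sub>n\<close> then satisfies \<open>|h\<^sub>\<plusminus>B| \<le> (h (k - 1) + 1) d\<close>.
\<close>

section \<open>Kneser's theorem\<close>

definition set_stabilizer :: "'a::ab_group_add set \<Rightarrow> 'a set" where
  "set_stabilizer X = {x. (+) x ` X = X}"

text \<open>A translation is injective, so one that maps a finite set into itself maps it onto
  itself.\<close>

lemma set_stabilizerI:
  assumes "finite X" "\<And>y. y \<in> X \<Longrightarrow> x + y \<in> X"
  shows "x \<in> set_stabilizer X"
proof -
  have "(+) x ` X = X"
    using assms by (intro card_subset_eq) (auto simp: card_image)
  then show ?thesis by (simp add: set_stabilizer_def)
qed

lemma set_stabilizerD: "x \<in> set_stabilizer X \<Longrightarrow> y \<in> X \<Longrightarrow> x + y \<in> X"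
  by (auto simp: set_stabilizer_def)

lemma set_stabilizer_minusD:
  assumes "x \<in> set_stabilizer X" "y \<in> X" shows "y - x \<in> X"
proof -
  have "y \<in> (+) x ` X" using assms by (simp add: set_stabilizer_def)
  then show ?thesis by auto
qed

lemma zero_in_set_stabilizer [simp]: "0 \<in> set_stabilizer X"
  by (simp add: set_stabilizer_def)

lemma finite_set_stabilizer:
  assumes "finite X" "X \<noteq> {}" shows "finite (set_stabilizer X)"
proof -
  obtain y where y: "y \<in> X" using assms by auto
  have "set_stabilizer X \<subseteq> (\<lambda>z. z - y) ` X"
  proof
    fix x assume "x \<in> set_stabilizer X"
    then have "x + y \<in> X" using y by (rule set_stabilizerD)
    then show "x \<in> (\<lambda>z. z - y) ` X" by (intro image_eqI[of _ _ "x + y"]) auto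
  qed
  then show ?thesis using assms finite_subset by blast
qed

lemma set_stabilizer_add:
  "x \<in> set_stabilizer X \<Longrightarrow> y \<in> set_stabilizer X \<Longrightarrow> x + y \<in> set_stabilizer X"
  by (simp add: set_stabilizer_def image_image add.assoc flip: image_image[of "(+) x" "(+) y"])

lemma set_stabilizer_uminus:
  assumes "x \<in> set_stabilizer X" shows "- x \<in> set_stabilizer X"
proof -
  have "(+) (- x) ` ((+) x ` X) = X" by (simp add: image_image)
  then show ?thesis using assms by (simp add: set_stabilizer_def)
qed

lemma set_stabilizer_diff:
  "x \<in> set_stabilizer X \<Longrightarrow> y \<in> set_stabilizer X \<Longrightarrow> x - y \<in> set_stabilizer X"
  using set_stabilizer_add[OF _ set_stabilizer_uminus] by force

lemma set_stabilizer_translate [simp]: "set_stabilizer ((+) t ` X) = set_stabilizer X"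
proof -
  have "(+) x ` (+) t ` X = (+) t ` (+) x ` X" for x
    by (simp add: image_image ac_simps)
  then show ?thesis by (simp add: set_stabilizer_def inj_image_eq_iff)
qed

text \<open>\<open>X\<close> is a union of cosets of the stabilizer of \<open>Y\<close>, and
  removing one coset leaves a smaller set of the same kind. With \<open>X\<close> distinct from
  \<open>Y\<close> this later yields Lagrange's theorem for the copy of \<int>/n and the number of
  cosets meeting a set.\<close>

lemma card_set_stabilizer_dvd:
  assumes "finite X" "\<And>x y. x \<in> set_stabilizer Y \<Longrightarrow> y \<in> X \<Longrightarrow> x + y \<in> X"
  shows "card (set_stabilizer Y) dvd card X"
  using assms
proof (induction "card X" arbitrary: X rule: less_induct)
  case less
  let ?H = "set_stabilizer Y"
  show ?case
  proof (cases "X = {}")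
    case False
    then obtain y where y: "y \<in> X" by auto
    let ?c = "(\<lambda>x. x + y) ` ?H"
    have sub: "?c \<subseteq> X" using less.prems y by auto
    have yc: "y \<in> ?c" by (intro image_eqI[of _ _ 0]) auto
    have cc: "card ?c = card ?H" by (intro card_image) (auto simp: inj_on_def)
    have "card ?H dvd card (X - ?c)"
    proof (rule less.hyps)
      show "card (X - ?c) < card X" using less.prems(1) y yc by (intro psubset_card_mono) blast+
      show "finite (X - ?c)" using less.prems by auto
      fix x z assume x: "x \<in> ?H" and z: "z \<in> X - ?c"
      have "x + z \<notin> ?c"
      proof
        assume "x + z \<in> ?c"
        then obtain w where w: "w \<in> ?H" "x + z = w + y" by auto
        then have "z = (w - x) + y" by (simp add: algebra_simps)
        then have "z \<in> ?c" using set_stabilizer_diff[OF w(1) x] by blast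
        with z show False by auto
      qed
      then show "x + z \<in> X - ?c" using less.prems x z by auto
    qed
    moreover have "card X = card (X - ?c) + card ?H"
      using card_Diff_subset[of ?c X] card_mono[OF less.prems(1) sub] sub less.prems(1) cc
      by (simp add: finite_subset)
    ultimately show ?thesis by simp
  qed simp
qed

text \<open>Pairs are counted by their sum: subtracting a fixed first coordinate embeds each fibre
  of addition on \<open>X \<times> Y\<close> into \<open>L\<close>.\<close>

lemma card_mult_le_card_plus:
  fixes X Y :: "'a::ab_group_add set"
  assumes "finite X" "finite Y" "finite L"
    and diff: "\<And>x x' y y'. x \<in> X \<Longrightarrow> x' \<in> X \<Longrightarrow> y \<in> Y \<Longrightarrow> y' \<in> Y \<Longrightarrow>
      x + y = x' + y' \<Longrightarrow> x - x' \<in> L"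
  shows "card X * card Y \<le> card L * card (X + Y)"
proof -
  let ?s = "\<lambda>p. fst p + snd p"
  have fib: "card {p \<in> X \<times> Y. ?s p = z} \<le> card L" for z
  proof (cases "{p \<in> X \<times> Y. ?s p = z} = {}")
    case False
    then obtain x' y' where x': "x' \<in> X" "y' \<in> Y" "x' + y' = z" by auto
    have "inj_on (\<lambda>p. fst p - x') {p \<in> X \<times> Y. ?s p = z}"
      by (auto simp: inj_on_def)
    moreover have "(\<lambda>p. fst p - x') ` {p \<in> X \<times> Y. ?s p = z} \<subseteq> L"
      using diff x' by auto
    ultimately show ?thesis using card_inj_on_le assms(3) by blast
  next
    case True
    then show ?thesis by (metis card.empty le0)
  qed
  have "X \<times> Y = (\<Union>z \<in> X + Y. {p \<in> X \<times> Y. ?s p = z})"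
    by (auto intro: set_plus_intro)
  then have "card (X \<times> Y) \<le> (\<Sum>z \<in> X + Y. card {p \<in> X \<times> Y. ?s p = z})"
    using card_UN_le[of "X + Y" "\<lambda>z. {p \<in> X \<times> Y. ?s p = z}"] assms by (simp add: finite_set_plus)
  also have "\<dots> \<le> card L * card (X + Y)"
    using sum_mono[of "X + Y" _ "\<lambda>_. card L"] fib by (simp add: mult.commute)
  finally show ?thesis using assms by (simp add: card_cartesian_product)
qed

text \<open>The quadratic \<open>b * (q - b)\<close> is concave in \<open>b\<close>, so on an
  interval centred at \<open>q / 2\<close> it is smallest at the ends.\<close>

lemma mult_diff_ge:
  fixes b m q :: int
  assumes "m \<le> b" "b \<le> q - m"
  shows "m * (q - m) \<le> b * (q - b)"
proof -
  have "0 \<le> (b - m) * (q - m - b)" using assms by (intro mult_nonneg_nonneg) auto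
  then show ?thesis by (simp add: algebra_simps)
qed

text \<open>
  The coset \<open>c + H\<^sub>1 + H\<^sub>2\<close>, where \<open>H\<^sub>1\<close> and \<open>H\<^sub>2\<close> stabilize \<open>P\<close> and \<open>Q\<close>, is a grid on which \<open>P\<close> is a
  union of rows and \<open>Q\<close> a union of columns. So \<open>Q - P\<close> and \<open>P - Q\<close> contain subgrids, and
  multiplying their sizes shows that they cannot both be small.
\<close>

lemma card_stabilizer_Diff_cases:
  fixes P Q :: "'a::ab_group_add set"
  assumes fin: "finite P" "finite Q" and ne: "P \<noteq> {}"
    and c: "c \<in> Q" "c \<notin> P"
    and le: "card (set_stabilizer P) \<le> card (set_stabilizer Q)"
  defines "m \<equiv> card (set_stabilizer P \<inter> set_stabilizer Q)"
  shows "card (set_stabilizer P) \<le> card (Q - P) + m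
    \<or> card (set_stabilizer Q) \<le> card (P - Q) + m"
proof -
  let ?H1 = "set_stabilizer P" and ?H2 = "set_stabilizer Q"
  let ?L = "?H1 \<inter> ?H2"
  have f1: "finite ?H1" and f2: "finite ?H2"
    using fin ne c by (auto intro: finite_set_stabilizer)
  \<comment> \<open>For \<open>x \<in> ?H2\<close> and \<open>y \<in> ?H1\<close>, the grid point
    \<open>x + y + c\<close> lies in \<open>P\<close> iff \<open>x \<in> U\<close>, and in
    \<open>Q\<close> iff \<open>y \<in> V\<close>. So \<open>Q - P\<close> contains a translate of
    \<open>(?H2 - U) + V\<close>, and \<open>P - Q\<close> one of
    \<open>U + (?H1 - V)\<close>.\<close>
  define U where "U = {x \<in> ?H2. x + c \<in> P}"
  define V where "V = {x \<in> ?H1. x + c \<in> Q}"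
  have fU: "finite U" "finite V" using f1 f2 by (auto simp: U_def V_def)
  have trans: "card X \<le> card Y" if "finite Y" "\<And>x. x \<in> X \<Longrightarrow> x + c \<in> Y" for X Y
    using that card_inj_on_le[of "\<lambda>x. x + c" X Y] by (auto simp: inj_on_def)
  have notP: "x + c \<notin> P" if "x \<in> ?H1" for x
    using set_stabilizer_minusD[OF that, of "x + c"] c by auto
  have inQ: "x + c \<in> Q" if "x \<in> ?H2" for x
    using set_stabilizerD[OF that] c by auto
  consider "U = {}" | "V = ?H1" | "U \<noteq> {}" "V \<noteq> ?H1" by blast
  then show ?thesis
  proof cases
    case 1
    have "card ?H2 \<le> card (Q - P)"
      using 1 inQ fin by (intro trans) (auto simp: U_def)
    then show ?thesis using le by simp
  next
    case 2
    have "card ?H1 \<le> card (Q - P)"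
      using 2 notP fin by (intro trans) (auto simp: V_def)
    then show ?thesis by simp
  next
    case 3
    \<comment> \<open>In this case \<open>U\<close>, \<open>?H2 - U\<close>, \<open>V\<close> and
      \<open>?H1 - V\<close> are all nonempty and closed under adding elements of \<open>?L\<close>,
      so each has at least \<open>m\<close> elements.\<close>
    have mU: "m \<le> card U"
    proof -
      obtain u where u: "u \<in> U" using 3 by auto
      have "card ?L \<le> card U"
      proof (rule card_inj_on_le[of "\<lambda>x. x + u"])
        show "(\<lambda>x. x + u) ` ?L \<subseteq> U"
          using u by (auto simp: U_def add.assoc intro: set_stabilizer_add set_stabilizerD)
      qed (use fU in \<open>auto simp: inj_on_def\<close>)
      then show ?thesis by (simp add: m_def)
    qed
    have mU': "m \<le> card (?H2 - U)"
      unfolding m_def using f2 notP by (intro card_mono) (auto simp: U_def)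
    have mV: "m \<le> card V"
      unfolding m_def using fU inQ by (intro card_mono) (auto simp: V_def)
    have mV': "m \<le> card (?H1 - V)"
    proof -
      obtain v where v: "v \<in> ?H1" "v + c \<notin> Q" using 3 by (auto simp: V_def)
      have "card ?L \<le> card (?H1 - V)"
      proof (rule card_inj_on_le[of "\<lambda>x. x + v"])
        have "x + v + c \<notin> Q" if "x \<in> ?H2" for x
          using set_stabilizer_minusD[OF that, of "x + v + c"] v by auto
        then show "(\<lambda>x. x + v) ` ?L \<subseteq> ?H1 - V"
          using v by (auto simp: V_def intro: set_stabilizer_add)
      qed (use f1 in \<open>auto simp: inj_on_def\<close>)
      then show ?thesis by (simp add: m_def)
    qed
    have cU: "card (?H2 - U) = card ?H2 - card U" "card U \<le> card ?H2"
      and cV: "card (?H1 - V) = card ?H1 - card V" "card V \<le> card ?H1"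
      using f1 f2 fU by (auto simp: U_def V_def intro!: card_Diff_subset card_mono)
    have diffL: "x - x' \<in> ?L" if "x \<in> ?H2" "x' \<in> ?H2" "y \<in> ?H1" "y' \<in> ?H1" "x + y = x' + y'"
      for x x' y y'
    proof -
      have "x - x' = y' - y" using that by (simp add: algebra_simps)
      then show ?thesis
        using set_stabilizer_diff[OF that(1,2)] set_stabilizer_diff[OF that(4,3)] by auto
    qed
    have fL: "finite ?L" using f1 by auto
    have 4: "card (?H2 - U) * card V \<le> m * card (Q - P)"
    proof -
      have "card (?H2 - U) * card V \<le> m * card ((?H2 - U) + V)"
        unfolding m_def
      proof (rule card_mult_le_card_plus)
        fix x x' y y' assume "x \<in> ?H2 - U" "x' \<in> ?H2 - U" "y \<in> V" "y' \<in> V" "x + y = x' + y'"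
        then show "x - x' \<in> ?L" by (intro diffL[of x x' y y']) (auto simp: V_def)
      qed (use fU f2 fL in auto)
      also have "card ((?H2 - U) + V) \<le> card (Q - P)"
      proof (rule trans)
        fix z assume "z \<in> (?H2 - U) + V"
        then obtain x y where xy: "z = x + y" "x \<in> ?H2" "x + c \<notin> P" "y \<in> ?H1" "y + c \<in> Q"
          by (auto simp: U_def V_def elim!: set_plus_elim)
        have "z + c \<in> Q" using set_stabilizerD[OF xy(2,5)] xy by (simp add: ac_simps)
        moreover have "z + c \<notin> P"
          using set_stabilizer_minusD[OF xy(4), of "z + c"] xy by (auto simp: algebra_simps)
        ultimately show "z + c \<in> Q - P" by simp
      qed (use fin in auto)
      finally show ?thesis by simp
    qed
    have 5: "card U * card (?H1 - V) \<le> m * card (P - Q)"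
    proof -
      have "card U * card (?H1 - V) \<le> m * card (U + (?H1 - V))"
        unfolding m_def
      proof (rule card_mult_le_card_plus)
        fix x x' y y' assume "x \<in> U" "x' \<in> U" "y \<in> ?H1 - V" "y' \<in> ?H1 - V" "x + y = x' + y'"
        then show "x - x' \<in> ?L" by (intro diffL[of x x' y y']) (auto simp: U_def)
      qed (use fU f1 fL in auto)
      also have "card (U + (?H1 - V)) \<le> card (P - Q)"
      proof (rule trans)
        fix z assume "z \<in> U + (?H1 - V)"
        then obtain x y where xy: "z = x + y" "x \<in> ?H2" "x + c \<in> P" "y \<in> ?H1" "y + c \<notin> Q"
          by (auto simp: U_def V_def elim!: set_plus_elim)
        have "z + c \<in> P" using set_stabilizerD[OF xy(4,3)] xy by (simp add: ac_simps)
        moreover have "z + c \<notin> Q"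
          using set_stabilizer_minusD[OF xy(2), of "z + c"] xy by (auto simp: algebra_simps)
        ultimately show "z + c \<in> P - Q" by simp
      qed (use fin in auto)
      finally show ?thesis by simp
    qed
    define p q u v X Y M where
      "p = int (card ?H1)" "q = int (card ?H2)" "u = int (card U)" "v = int (card V)"
      "X = int (card (Q - P))" "Y = int (card (P - Q))" "M = int m"
    note d = this
    have "m > 0" unfolding m_def using fL zero_in_set_stabilizer by (metis IntI card_gt_0_iff empty_iff)
    then have M: "M > 0" by (simp add: d)
    have i: "(q - u) * v \<le> M * X" "u * (p - v) \<le> M * Y"
      using 4 5 unfolding d cU(1) cV(1) of_nat_diff[OF cU(2), symmetric]
        of_nat_diff[OF cV(2), symmetric] of_nat_mult[symmetric] of_nat_le_iff .
    have r: "M \<le> u" "u \<le> q - M" "M \<le> v" "v \<le> p - M"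
      using mU mU' mV mV' cU cV unfolding d by linarith+
    \<comment> \<open>The product of the two bounds in \<open>i\<close> regroups into
      \<open>v * (p - v)\<close> times \<open>u * (q - u)\<close>, where \<open>mult_diff_ge\<close>
      applies. Cancelling \<open>M * M\<close> leaves an inequality that fails if both
      \<open>X < p - M\<close> and \<open>Y < q - M\<close>.\<close>
    have "(M * (p - M)) * (M * (q - M)) \<le> (v * (p - v)) * (u * (q - u))"
      using r M by (intro mult_mono mult_diff_ge mult_nonneg_nonneg) auto
    also have "\<dots> = ((q - u) * v) * (u * (p - v))" by (simp add: algebra_simps)
    also have "\<dots> \<le> (M * X) * (M * Y)"
    proof (rule mult_mono[OF i])
      show "0 \<le> M * X" "0 \<le> u * (p - v)" using r M by (auto simp: d)
    qed
    finally have "(M * M) * ((p - M) * (q - M)) \<le> (M * M) * (X * Y)" by (simp add: ac_simps)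
    then have 6: "(p - M) * (q - M) \<le> X * Y" using M by simp
    have "p \<le> X + M \<or> q \<le> Y + M"
    proof (rule ccontr)
      assume "\<not> ?thesis"
      then have "X < p - M" "Y < q - M" by auto
      then have "X * Y < (p - M) * (q - M)"
        by (intro mult_strict_mono') (auto simp: d)
      with 6 show False by simp
    qed
    then show ?thesis by (simp add: d flip: of_nat_add)
  qed
qed

text \<open>By symmetry the stabilizer of \<open>P\<close> may be taken to be the smaller one. Then
  passing from one of the two sets to the union gains at least the size of its stabilizer minus that
  of the common stabilizer, and the common stabilizer also fixes the union.\<close>

lemma card_Un_add_card_set_stabilizer_ge:
  fixes P Q :: "'a::ab_group_add set"
  assumes "finite P" "finite Q" "P \<noteq> {}" "Q \<noteq> {}"
    and "r \<le> card P + card (set_stabilizer P)" "r \<le> card Q + card (set_stabilizer Q)"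
  shows "r \<le> card (P \<union> Q) + card (set_stabilizer (P \<union> Q))"
proof -
  have *: "r \<le> card (P \<union> Q) + card (set_stabilizer (P \<union> Q))"
    if fin: "finite P" "finite Q" "P \<noteq> {}" "Q \<noteq> {}"
      and r: "r \<le> card P + card (set_stabilizer P)" "r \<le> card Q + card (set_stabilizer Q)"
      and le: "card (set_stabilizer P) \<le> card (set_stabilizer Q)"
    for P Q :: "'a set"
  proof (cases "Q \<subseteq> P")
    case True
    then show ?thesis using r by (simp add: Un_absorb2)
  next
    case False
    then obtain c where c: "c \<in> Q" "c \<notin> P" by auto
    have "set_stabilizer P \<inter> set_stabilizer Q \<subseteq> set_stabilizer (P \<union> Q)"
      by (auto simp: set_stabilizer_def image_Un)
    then have "card (set_stabilizer P \<inter> set_stabilizer Q) \<le> card (set_stabilizer (P \<union> Q))"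
      using fin by (intro card_mono finite_set_stabilizer) auto
    moreover have "card (P \<union> Q) = card P + card (Q - P)" "card (P \<union> Q) = card Q + card (P - Q)"
      using fin card_Un_disjoint[of P "Q - P"] card_Un_disjoint[of Q "P - Q"]
      by (auto simp: Un_commute)
    ultimately show ?thesis
      using card_stabilizer_Diff_cases[OF fin(1-3) c le] r by linarith
  qed
  show ?thesis
    using *[of P Q] *[of Q P] assms by (metis Un_commute linear)
qed

text \<open>
  Apply Dyson's transform \<open>(A, B) \<mapsto> (A \<union> (B + t), B \<inter> (A - t))\<close> while it shrinks \<open>B\<close>. When it no longer
  does, \<open>B - b\<close> lies in the stabilizer of \<open>A\<close>, and \<open>A + B\<close> is the translate \<open>A + b\<close>.
\<close>

lemma ex_large_stabilizer_subset:
  fixes A B :: "'a::ab_group_add set"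
  assumes "finite A" "finite B" "a \<in> A" "b \<in> B"
  shows "\<exists>C \<subseteq> A + B. a + b \<in> C \<and> card A + card B \<le> card C + card (set_stabilizer C)"
  using assms
proof (induction "card B" arbitrary: A B rule: less_induct)
  case less
  show ?case
  proof (cases "\<forall>e\<in>A. \<forall>y\<in>B. y + (e - b) \<in> A")
    case True
    have eq: "A + B = (+) b ` A"
    proof
      show "A + B \<subseteq> (+) b ` A"
      proof
        fix z assume "z \<in> A + B"
        then obtain x y where "z = x + y" "x \<in> A" "y \<in> B" by (auto elim!: set_plus_elim)
        then show "z \<in> (+) b ` A"
          using True by (intro image_eqI[of _ _ "y + (x - b)"]) auto
      qed
      show "(+) b ` A \<subseteq> A + B" using less by (auto simp: add.commute[of b] intro: set_plus_intro)
    qed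
    have "card B \<le> card (set_stabilizer A)"
    proof (rule card_inj_on_le[of "\<lambda>y. y - b"])
      have "(y - b) + e \<in> A" if "y \<in> B" "e \<in> A" for y e
        using True that by (simp add: algebra_simps)
      then show "(\<lambda>y. y - b) ` B \<subseteq> set_stabilizer A"
        using less.prems by (auto intro!: set_stabilizerI)
      show "finite (set_stabilizer A)" using less by (auto intro: finite_set_stabilizer)
    qed (auto simp: inj_on_def)
    then have "card A + card B \<le> card (A + B) + card (set_stabilizer (A + B))"
      by (simp add: eq card_image)
    moreover have "a + b \<in> A + B" using less by auto
    ultimately show ?thesis by blast
  next
    case False
    then obtain e y where e: "e \<in> A" "y \<in> B" "y + (e - b) \<notin> A" by auto
    \<comment> \<open>This shift keeps \<open>b\<close> in the new second set, since
      \<open>b + t = e\<close>, and drops \<open>y\<close> from it, so the induction hypothesis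
      applies with the same \<open>a\<close> and \<open>b\<close>.\<close>
    define t where "t = e - b"
    let ?A = "A \<union> (\<lambda>y. y + t) ` B" and ?B = "{y \<in> B. y + t \<in> A}"
    have "card ?B < card B" using e less by (intro psubset_card_mono) (auto simp: t_def)
    moreover have "b \<in> ?B" using e less by (auto simp: t_def)
    ultimately obtain C where C: "C \<subseteq> ?A + ?B" "a + b \<in> C"
      "card ?A + card ?B \<le> card C + card (set_stabilizer C)"
      using less.hyps[of ?B ?A] less.prems by auto
    have "?A + ?B \<subseteq> A + B"
    proof
      fix z assume "z \<in> ?A + ?B"
      then obtain x y where z: "z = x + y" "x \<in> ?A" "y \<in> B" "y + t \<in> A"
        by (auto elim!: set_plus_elim)
      show "z \<in> A + B"
      proof (cases "x \<in> A")
        case False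
        then obtain w where "w \<in> B" "x = w + t" using z by auto
        then have "z = (y + t) + w" using z by (simp add: ac_simps)
        then show ?thesis using set_plus_intro[OF z(4) \<open>w \<in> B\<close>] by simp
      qed (use z in auto)
    qed
    moreover have "card ?A + card ?B = card A + card B"
    proof -
      have inj: "inj_on (\<lambda>y. y + t) Z" for Z by (auto simp: inj_on_def)
      have "A \<inter> (\<lambda>y. y + t) ` B = (\<lambda>y. y + t) ` ?B" by auto
      then have "card ?B = card (A \<inter> (\<lambda>y. y + t) ` B)" by (simp add: card_image[OF inj])
      then show ?thesis
        using card_Un_Int[of A "(\<lambda>y. y + t) ` B"] less.prems by (simp add: card_image[OF inj])
    qed
    ultimately show ?thesis using C by auto
  qed
qed

text \<open>Every element of \<open>A + B\<close> lies in a subset \<open>F c\<close> that satisfies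
  the inequality. The inequality passes to unions, and the union of all these subsets is
  \<open>A + B\<close> itself.\<close>

theorem Kneser:
  fixes A B :: "'a::ab_group_add set"
  assumes "finite A" "finite B" "A \<noteq> {}" "B \<noteq> {}"
  shows "card A + card B \<le> card (A + B) + card (set_stabilizer (A + B))"
proof -
  have fin: "finite (A + B)" using assms by (simp add: finite_set_plus)
  have "\<exists>C \<subseteq> A + B. c \<in> C \<and> card A + card B \<le> card C + card (set_stabilizer C)"
    if "c \<in> A + B" for c
    using that ex_large_stabilizer_subset[OF assms(1,2)] by (auto elim!: set_plus_elim)
  then obtain F where F: "\<And>c. c \<in> A + B \<Longrightarrow> F c \<subseteq> A + B" "\<And>c. c \<in> A + B \<Longrightarrow> c \<in> F c"
    "\<And>c. c \<in> A + B \<Longrightarrow> card A + card B \<le> card (F c) + card (set_stabilizer (F c))"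
    by metis
  have "card A + card B \<le> card (\<Union>(F ` S)) + card (set_stabilizer (\<Union>(F ` S)))"
    if "finite S" "S \<noteq> {}" "S \<subseteq> A + B" for S
    using that
  proof (induction S rule: finite_ne_induct)
    case (singleton c)
    then show ?case using F by simp
  next
    case (insert c S)
    have c: "c \<in> A + B" and S: "S \<subseteq> A + B" using insert by auto
    have "finite (F c)" "F c \<noteq> {}" using F(1,2)[OF c] fin finite_subset by auto
    moreover have "finite (\<Union>(F ` S))" "\<Union>(F ` S) \<noteq> {}"
      using F(1,2) S insert.hyps(2) fin by (blast intro: finite_subset)+
    ultimately show ?case
      using card_Un_add_card_set_stabilizer_ge[of "F c" "\<Union>(F ` S)"] insert.IH[OF S] F(3)[OF c]
      by simp
  qed
  moreover have "\<Union>(F ` (A + B)) = A + B" using F by blast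
  moreover have "A + B \<noteq> {}" using assms by (auto simp: set_plus_def)
  ultimately show ?thesis using fin by (metis subset_refl)
qed

section \<open>Iterated sumsets and the iterated form of Kneser's theorem\<close>

primrec nfold_sum :: "nat \<Rightarrow> 'a::comm_monoid_add set \<Rightarrow> 'a set" where
  "nfold_sum 0 A = {0}"
| "nfold_sum (Suc h) A = A + nfold_sum h A"

lemma finite_nfold_sum: "finite A \<Longrightarrow> finite (nfold_sum h A)"
  by (induction h) (auto simp: finite_set_plus)

lemma nfold_sum_nonempty: "A \<noteq> {} \<Longrightarrow> nfold_sum h A \<noteq> {}"
  by (induction h) (auto simp: set_plus_def)

lemma nfold_sum_add: "nfold_sum (i + j) A = nfold_sum i A + nfold_sum j A"
  by (induction i) (simp_all add: add.assoc)

lemma nfold_sum_image: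
  assumes "\<And>x y. f (x + y) = f x + f y" "f 0 = 0"
  shows "nfold_sum h (f ` A) = f ` nfold_sum h A"
proof (induction h)
  case (Suc h)
  have "f ` A + f ` B = f ` (A + B)" for B
    by (auto simp: set_plus_image image_iff assms(1)) blast+
  then show ?case by (simp add: Suc)
qed (simp add: assms)

text \<open>The copies of \<open>H\<close> contributed by the summands merge into one. The successor
  matters: with no summands the left side would be \<open>{0}\<close> and the right side
  \<open>H\<close>.\<close>

lemma nfold_sum_plus_idem:
  assumes "H + H = H"
  shows "nfold_sum (Suc j) (A + H) = nfold_sum (Suc j) A + H"
proof (induction j)
  case 0
  show ?case by (auto simp: set_plus_def)
next
  case (Suc j)
  have "nfold_sum (Suc (Suc j)) (A + H) = (A + H) + (nfold_sum (Suc j) A + H)"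
    using Suc by simp
  also have "\<dots> = (A + nfold_sum (Suc j) A) + (H + H)" by (simp only: ac_simps)
  finally show ?case by (simp add: assms)
qed

text \<open>Replacing \<open>A\<close> by \<open>A + H\<close> leaves the \<open>h\<close>-fold
  sumset unchanged. Kneser's theorem is then applied once for each added summand, and each time
  costs \<open>card H\<close>. The terms are arranged to avoid subtraction.\<close>

lemma Kneser_nfold_sum:
  fixes A :: "'a::ab_group_add set"
  assumes fin: "finite A" and ne: "A \<noteq> {}" and h: "h > 0"
  defines "H \<equiv> set_stabilizer (nfold_sum h A)"
  shows "h * card (A + H) + card H \<le> card (nfold_sum h A) + h * card H"
proof -
  let ?A = "A + H"
  have fH: "finite H"
    unfolding H_def by (intro finite_set_stabilizer finite_nfold_sum nfold_sum_nonempty fin ne)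
  have H0: "0 \<in> H" by (simp add: H_def)
  have HH: "H + H = H"
  proof
    show "H + H \<subseteq> H"
      by (auto elim!: set_plus_elim simp: H_def intro: set_stabilizer_add)
  qed (rule set_zero_plus2[OF H0])
  have fA: "finite ?A" "?A \<noteq> {}" using fin fH ne H0 by (auto simp: finite_set_plus set_plus_def)
  have hA: "nfold_sum h ?A = nfold_sum h A"
  proof -
    have "nfold_sum h ?A = nfold_sum h A + H"
      using nfold_sum_plus_idem[OF HH, of "h - 1" A] h by simp
    also have "\<dots> = H + nfold_sum h A" by (rule add.commute)
    also have "\<dots> = nfold_sum h A"
    proof
      show "H + nfold_sum h A \<subseteq> nfold_sum h A"
        by (auto elim!: set_plus_elim simp: H_def intro: set_stabilizerD)
    qed (rule set_zero_plus2[OF H0])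
    finally show ?thesis .
  qed
  txt \<open>All the intermediate sumsets have the same stabilizer, so the error terms in Kneser's theorem agree.\<close>
  have st: "set_stabilizer (nfold_sum (Suc j) ?A) = H" if "Suc j \<le> h" for j
  proof
    show "H \<subseteq> set_stabilizer (nfold_sum (Suc j) ?A)"
    proof
      fix x assume x: "x \<in> H"
      have "x + y \<in> ?A + nfold_sum j ?A" if y': "y \<in> ?A + nfold_sum j ?A" for y
      proof -
        obtain g s where g: "y = g + s" "g \<in> ?A" "s \<in> nfold_sum j ?A"
          using y' by (rule set_plus_elim)
        obtain a k where "g = a + k" "a \<in> A" "k \<in> H"
          using g(2) by (rule set_plus_elim)
        with g have y: "y = (a + k) + s" "a \<in> A" "k \<in> H" "s \<in> nfold_sum j ?A" by auto
        have "x + y = (a + (x + k)) + s" using y by (simp add: ac_simps)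
        moreover have "x + k \<in> H" using x y HH by (metis set_plus_intro)
        ultimately show ?thesis using y by (metis set_plus_intro)
      qed
      then show "x \<in> set_stabilizer (nfold_sum (Suc j) ?A)"
        using fA by (intro set_stabilizerI finite_nfold_sum) auto
    qed
    \<comment> \<open>A partial sumset is a summand of the full \<open>h\<close>-fold sumset, so
      whatever stabilizes it stabilizes the whole.\<close>
    show "set_stabilizer (nfold_sum (Suc j) ?A) \<subseteq> H"
    proof
      fix x assume x: "x \<in> set_stabilizer (nfold_sum (Suc j) ?A)"
      have eq: "nfold_sum h A = nfold_sum (Suc j) ?A + nfold_sum (h - Suc j) ?A"
        using nfold_sum_add[of "Suc j" "h - Suc j" ?A] \<open>Suc j \<le> h\<close> hA by simp
      show "x \<in> H" unfolding H_def
      proof (rule set_stabilizerI)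
        fix y assume "y \<in> nfold_sum h A"
        then obtain u v where "y = u + v" "u \<in> nfold_sum (Suc j) ?A" "v \<in> nfold_sum (h - Suc j) ?A"
          unfolding eq by (auto elim!: set_plus_elim)
        then show "x + y \<in> nfold_sum h A"
          unfolding eq using set_stabilizerD[OF x] by (metis add.assoc set_plus_intro)
      qed (intro finite_nfold_sum fin)
    qed
  qed
  have "Suc j * card ?A + card H \<le> card (nfold_sum (Suc j) ?A) + Suc j * card H" if "Suc j \<le> h" for j
    using that
  proof (induction j)
    case 0
    have "nfold_sum (Suc 0) ?A = ?A" by (auto simp: set_plus_def)
    then show ?case by simp
  next
    case (Suc j)
    have "card ?A + card (nfold_sum (Suc j) ?A) \<le> card (nfold_sum (Suc (Suc j)) ?A) + card H"
      using Kneser[OF fA(1) finite_nfold_sum[OF fA(1)] fA(2) nfold_sum_nonempty[OF fA(2)], of "Suc j"]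
        st[OF Suc.prems] by simp
    then show ?case using Suc by simp
  qed
  from this[of "h - 1"] show ?thesis using h hA by simp
qed

section \<open>Sumsets in cyclic groups\<close>

text \<open>
  All the groups \<open>\<int>\<^sub>n\<close> embed into \<open>\<rat> / \<int>\<close>, so this one type brings the type-class version of
  Kneser's theorem to bear on every \<open>n\<close>.
\<close>

quotient_type rat_mod_int = rat / "\<lambda>x y. x - y \<in> \<int>"
proof (rule equivpI)
  show "symp (\<lambda>x y::rat. x - y \<in> \<int>)"
    by (rule sympI) (metis Ints_minus minus_diff_eq)
  show "transp (\<lambda>x y::rat. x - y \<in> \<int>)"
  proof (rule transpI)
    fix x y z :: rat assume "x - y \<in> \<int>" "y - z \<in> \<int>"
    then show "x - z \<in> \<int>" using Ints_add by fastforce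
  qed
qed (simp add: reflp_def)

instantiation rat_mod_int :: ab_group_add
begin

lift_definition zero_rat_mod_int :: rat_mod_int is 0 .

lift_definition plus_rat_mod_int :: "rat_mod_int \<Rightarrow> rat_mod_int \<Rightarrow> rat_mod_int" is "(+)"
  by (metis Ints_add add_diff_add)

lift_definition uminus_rat_mod_int :: "rat_mod_int \<Rightarrow> rat_mod_int" is uminus
  by (metis Ints_minus minus_diff_minus)

lift_definition minus_rat_mod_int :: "rat_mod_int \<Rightarrow> rat_mod_int \<Rightarrow> rat_mod_int" is "(-)"
  by (smt (verit) Ints_diff diff_diff_eq2 diff_add_eq add_diff_eq diff_diff_add add.commute)

instance
  by standard (transfer; simp add: algebra_simps)+

end

text \<open>The map is \<open>k \<mapsto> k / n\<close> modulo 1, whose kernel consists of the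
  multiples of \<open>n\<close>.\<close>

lemma ex_hom_to_rat_mod_int:
  assumes "n > 0"
  obtains f :: "int \<Rightarrow> rat_mod_int"
  where "\<And>x y. f (x + y) = f x + f y" "f 0 = 0" "\<And>x y. f x = f y \<longleftrightarrow> int n dvd x - y"
proof
  let ?f = "\<lambda>k. abs_rat_mod_int (of_int k / of_nat n)"
  show "?f (x + y) = ?f x + ?f y" for x y
    by (simp add: plus_rat_mod_int.abs_eq add_divide_distrib)
  show "?f 0 = 0" by (simp add: zero_rat_mod_int.abs_eq)
  show "?f x = ?f y \<longleftrightarrow> int n dvd x - y" for x y
  proof -
    have "?f x = ?f y \<longleftrightarrow> (of_int (x - y) / of_nat n :: rat) \<in> \<int>"
      by (simp add: rat_mod_int.abs_eq_iff diff_divide_distrib)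
    also have "\<dots> \<longleftrightarrow> int n dvd x - y"
      using assms of_int_div_of_int_in_Ints_iff[of "x - y" "int n", where ?'a = rat] by simp
    finally show ?thesis .
  qed
qed

section \<open>Sumsets of residues as integer combinations\<close>

lemma finprod_integer_mod_group:
  assumes "finite A" "n > 0"
  shows "finprod (integer_mod_group n) (\<lambda>a. g a mod int n) A = (\<Sum>a\<in>A. g a) mod int n"
proof -
  interpret comm_group "integer_mod_group n" by simp
  have "g a mod int n \<in> carrier (integer_mod_group n)" for a
    using assms by (simp add: carrier_integer_mod_group)
  then have *: "(\<lambda>a. g a mod int n) \<in> B \<rightarrow> carrier (integer_mod_group n)" for B by auto
  show ?thesis using assms(1)
  proof induction
    case (insert x F)
    then show ?case using * by (subst finprod_insert) (auto simp: mod_add_eq)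
  qed simp
qed

lemma sumset_integer_mod_group:
  assumes "finite A" "n > 0"
  shows "sumset (integer_mod_group n) h A =
    {(\<Sum>a\<in>A. int (c a) * a) mod int n | c. (\<Sum>a\<in>A. c a) = h}"
  using assms by (simp add: sumset_def finprod_integer_mod_group)

lemma signed_sumset_integer_mod_group:
  assumes "finite A" "n > 0"
  shows "signed_sumset (integer_mod_group n) h A =
    {(\<Sum>a\<in>A. c a * a) mod int n | c. (\<Sum>a\<in>A. \<bar>c a\<bar>) = int h}"
  using assms by (simp add: signed_sumset_def int_pow_integer_mod_group finprod_integer_mod_group)

text \<open>The coefficient of \<open>a\<close> counts how often \<open>a\<close> is chosen among
  the \<open>h\<close> summands, so each further summand raises one coefficient by 1.\<close>

lemma nfold_sum_int_combination:
  fixes A :: "int set"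
  assumes "finite A" "x \<in> nfold_sum h A"
  shows "\<exists>c. (\<Sum>a\<in>A. c a) = h \<and> x = (\<Sum>a\<in>A. int (c a) * a)"
  using assms(2)
proof (induction h arbitrary: x)
  case 0
  then show ?case by (intro exI[of _ "\<lambda>_. 0"]) simp
next
  case (Suc h)
  then obtain a y where a: "a \<in> A" "y \<in> nfold_sum h A" "x = a + y"
    by (auto elim: set_plus_elim)
  then obtain c where c: "(\<Sum>a\<in>A. c a) = h" "y = (\<Sum>a\<in>A. int (c a) * a)"
    using Suc.IH by blast
  have "(\<Sum>b\<in>A. (c(a := Suc (c a))) b) = Suc h"
    using a(1) assms(1) c(1) by (simp add: sum.remove[of A a])
  moreover have "(\<Sum>b\<in>A. int ((c(a := Suc (c a))) b) * b) = x"
    using a assms(1) c(2) by (simp add: sum.remove[of A a] algebra_simps)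
  ultimately show ?case by metis
qed

text \<open>A coefficient \<open>c a\<close> stands for \<open>\<bar>c a\<bar>\<close> copies of
  \<open>a\<close> or of \<open>- a\<close>. The induction splits off one copy by moving a nonzero
  coefficient one step towards 0.\<close>

lemma signed_combination_in_nfold_sum:
  fixes A :: "int set"
  assumes "finite A" "(\<Sum>a\<in>A. \<bar>c a\<bar>) = int h"
  shows "(\<Sum>a\<in>A. c a * a) \<in> nfold_sum h (A \<union> uminus ` A)"
  using assms(2)
proof (induction h arbitrary: c)
  case 0
  then have "\<forall>a\<in>A. c a = 0" using assms(1) by (simp add: sum_nonneg_eq_0_iff)
  then show ?case by simp
next
  case (Suc h)
  then obtain a where a: "a \<in> A" "c a \<noteq> 0"
    by (metis (no_types, lifting) abs_zero of_nat_eq_0_iff nat.distinct(1) sum.neutral)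
  define c' where "c' = c(a := c a - sgn (c a))"
  have "\<bar>c a - sgn (c a)\<bar> = \<bar>c a\<bar> - 1" using a(2) by (simp add: sgn_if)
  then have "(\<Sum>b\<in>A. \<bar>c' b\<bar>) = int h"
    using Suc.prems a(1) assms(1) by (simp add: c'_def sum.remove[of A a])
  then have "(\<Sum>b\<in>A. c' b * b) \<in> nfold_sum h (A \<union> uminus ` A)" by (rule Suc.IH)
  moreover have "sgn (c a) * a \<in> A \<union> uminus ` A" using a by (simp add: sgn_if)
  moreover have "(\<Sum>b\<in>A. c b * b) = sgn (c a) * a + (\<Sum>b\<in>A. c' b * b)"
    using a(1) assms(1) by (simp add: c'_def sum.remove[of A a] algebra_simps)
  ultimately show ?case by (simp add: set_plus_intro)
qed

lemma sumset_subset_signed_sumset: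
  assumes "finite A" "n > 0"
  shows "sumset (integer_mod_group n) h A \<subseteq> signed_sumset (integer_mod_group n) h A"
proof
  fix x assume "x \<in> sumset (integer_mod_group n) h A"
  then obtain c where "(\<Sum>a\<in>A. c a) = h" "x = (\<Sum>a\<in>A. int (c a) * a) mod int n"
    by (auto simp: sumset_integer_mod_group assms)
  then show "x \<in> signed_sumset (integer_mod_group n) h A"
    by (auto simp: signed_sumset_integer_mod_group assms intro!: exI[of _ "\<lambda>a. int (c a)"])
qed

text \<open>Here \<open>d\<close> is the order of the stabilizer \<open>H\<close> of the
  \<open>h\<close>-fold sumset, \<open>N\<close> is the index of \<open>H\<close>, and
  \<open>k\<close> is the number of cosets of \<open>H\<close> that meet \<open>A\<close>. All of
  this is computed in the image of \<int>/n under \<open>f\<close>.\<close>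

lemma card_sumset_ge:
  assumes A: "A \<subseteq> carrier (integer_mod_group n)" "A \<noteq> {}" and pos: "n > 0" "h > 0"
  obtains d k N where "n = N * d" "0 < k" "k \<le> N" "card A \<le> k * d"
    "(h * (k - 1) + 1) * d \<le> card (sumset (integer_mod_group n) h A)"
proof -
  obtain f :: "int \<Rightarrow> rat_mod_int" where f: "\<And>x y. f (x + y) = f x + f y" "f 0 = 0"
    "\<And>x y. f x = f y \<longleftrightarrow> int n dvd x - y"
    using ex_hom_to_rat_mod_int[OF pos(1)] by metis
  have AC: "A \<subseteq> {0..<int n}" using A pos by (simp add: carrier_integer_mod_group)
  then have finA: "finite A" using finite_subset by blast
  have f_mod: "f (x mod int n) = f x" for x by (simp add: f(3) mod_eq_dvd_iff[symmetric])
  have inj: "inj_on f {0..<int n}"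
    by (rule inj_onI) (auto simp: f(3) mod_eq_dvd_iff[symmetric])
  let ?R = "f ` {0..<int n}"
  have f_R: "f x \<in> ?R" for x
    using pos by (intro image_eqI[of _ _ "x mod int n"]) (simp_all add: f_mod)
  have cardR: "card ?R = n" by (simp add: card_image inj)
  define X where "X = f ` A"
  have finX: "finite X" "X \<noteq> {}" using finA A by (auto simp: X_def)
  have cardX: "card X = card A"
    unfolding X_def using AC inj by (intro card_image) (rule inj_on_subset)
  let ?S = "nfold_sum h X"
  let ?H = "set_stabilizer ?S"
  have finS: "finite ?S" "?S \<noteq> {}" using finX by (simp_all add: finite_nfold_sum nfold_sum_nonempty)
  have S: "?S = f ` nfold_sum h A" unfolding X_def by (intro nfold_sum_image f)
  have f_minus: "f (x - y) = f x - f y" for x y using f(1)[of "x - y" y] by (simp add: algebra_simps)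
  \<comment> \<open>A stabilizing element is a difference of two elements of \<open>?S\<close>, and
    \<open>?S\<close> lies in the subgroup \<open>?R\<close>, the copy of \<int>/n.\<close>
  have HR: "?H \<subseteq> ?R"
  proof
    fix x assume x: "x \<in> ?H"
    obtain y where y: "y \<in> ?S" using finS by auto
    then have "x + y \<in> ?S" using x by (intro set_stabilizerD)
    then obtain u v where "x + y = f u" "y = f v" using y S by auto
    then have "x = f (u - v)" by (simp add: f_minus eq_diff_eq)
    then show "x \<in> ?R" using f_R by simp
  qed
  have add_R: "x + y \<in> ?R" if "x \<in> ?R" "y \<in> ?R" for x y
    using that f_R by (auto simp flip: f(1))
  have "card ?H dvd card ?R"
  proof (rule card_set_stabilizer_dvd)
    show "x + y \<in> ?R" if "x \<in> ?H" "y \<in> ?R" for x y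
      using that HR add_R by blast
  qed simp
  then obtain N where N: "n = N * card ?H" unfolding cardR by (auto simp: dvd_def mult.commute)
  have finH: "finite ?H" by (rule finite_set_stabilizer[OF finS])
  have finXH: "finite (X + ?H)" using finX finH by (simp add: finite_set_plus)
  have "card ?H dvd card (X + ?H)"
  proof (rule card_set_stabilizer_dvd[OF finXH])
    fix x y assume x: "x \<in> ?H" and "y \<in> X + ?H"
    then obtain a k where a: "y = a + k" "a \<in> X" "k \<in> ?H" by (auto elim: set_plus_elim)
    have "x + y = a + (x + k)" using a by (simp add: ac_simps)
    then show "x + y \<in> X + ?H" using a set_stabilizer_add[OF x] by (metis set_plus_intro)
  qed
  then obtain k where k: "card (X + ?H) = k * card ?H" by (auto simp: dvd_def mult.commute)
  have H_pos: "card ?H > 0" using finH zero_in_set_stabilizer card_gt_0_iff by blast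
  have sub: "X \<subseteq> X + ?H" using set_zero_plus2[of ?H X] by (simp add: add.commute)
  then have "card A \<le> k * card ?H" using card_mono[OF finXH] cardX k by metis
  moreover have "k > 0"
  proof (rule ccontr)
    assume "\<not> k > 0"
    then have "card (X + ?H) = 0" using k by simp
    then show False using finXH finX sub by simp
  qed
  moreover have "k \<le> N"
  proof -
    have "X + ?H \<subseteq> ?R"
    proof
      fix z assume "z \<in> X + ?H"
      then obtain x y where "z = x + y" "x \<in> X" "y \<in> ?H" by (rule set_plus_elim)
      moreover have "X \<subseteq> ?R" using AC by (auto simp: X_def)
      ultimately show "z \<in> ?R" using HR add_R by blast
    qed
    then have "card (X + ?H) \<le> card ?R" by (intro card_mono) auto
    then have "k * card ?H \<le> N * card ?H" unfolding cardR k N[symmetric] .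
    then show ?thesis using H_pos by simp
  qed
  moreover have "(h * (k - 1) + 1) * card ?H \<le> card (sumset (integer_mod_group n) h A)"
  proof -
    have "h * (k * card ?H) + card ?H \<le> card ?S + h * card ?H"
      using Kneser_nfold_sum[OF finX pos(2)] k by simp
    moreover have "h * (k * card ?H) = h * (k - 1) * card ?H + h * card ?H"
      using \<open>k > 0\<close> by (cases k) (simp_all add: algebra_simps)
    ultimately have 1: "(h * (k - 1) + 1) * card ?H \<le> card ?S"
      unfolding add_mult_distrib by linarith
    \<comment> \<open>\<open>f\<close> is unaffected by reduction modulo \<open>n\<close>, so
      integer combinations may be replaced by their residues.\<close>
    have "?S \<subseteq> f ` sumset (integer_mod_group n) h A"
    proof
      fix s assume "s \<in> ?S"
      then obtain x where x: "x \<in> nfold_sum h A" "s = f x" using S by auto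
      then obtain c where c: "(\<Sum>a\<in>A. c a) = h" "x = (\<Sum>a\<in>A. int (c a) * a)"
        using nfold_sum_int_combination[OF finA] by blast
      have "x mod int n \<in> sumset (integer_mod_group n) h A"
        using c by (auto simp: sumset_integer_mod_group finA pos)
      then show "s \<in> f ` sumset (integer_mod_group n) h A"
        unfolding x(2) f_mod[of x, symmetric] by (rule imageI)
    qed
    then have "card ?S \<le> card (sumset (integer_mod_group n) h A)"
    proof (rule surj_card_le[rotated])
      have "sumset (integer_mod_group n) h A \<subseteq> {0..<int n}"
        using pos by (auto simp: sumset_integer_mod_group finA)
      then show "finite (sumset (integer_mod_group n) h A)" by (rule finite_subset) simp
    qed
    with 1 show ?thesis by linarith
  qed
  ultimately show ?thesis using that N by blast
qed

section \<open>Small signed sumsets in cyclic groups\<close>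

lemma nfold_sum_progression:
  fixes x0 \<delta> :: int
  assumes "x \<in> nfold_sum h ((\<lambda>i. x0 + \<delta> * int i) ` {..<k})"
  shows "x \<in> (\<lambda>i. int h * x0 + \<delta> * int i) ` {..h * (k - 1)}"
  using assms
proof (induction h arbitrary: x)
  case (Suc h)
  then obtain i y where y: "x = x0 + \<delta> * int i + y" "i < k"
    "y \<in> nfold_sum h ((\<lambda>i. x0 + \<delta> * int i) ` {..<k})"
    by (auto elim!: set_plus_elim)
  then obtain j where j: "j \<le> h * (k - 1)" "y = int h * x0 + \<delta> * int j" using Suc.IH by auto
  have "x = int (Suc h) * x0 + \<delta> * int (i + j)" using y j by (simp add: algebra_simps)
  moreover have "i + j \<le> Suc h * (k - 1)" using y j by simp
  ultimately show ?case by blast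
qed simp

text \<open>Closure under negation is asked only modulo \<open>N\<close>, so that a set of
  representatives may contain \<open>N / 2\<close> without its negative.\<close>

definition symmetric_mod :: "nat \<Rightarrow> int set \<Rightarrow> bool" where
  "symmetric_mod N T \<longleftrightarrow> (\<forall>t\<in>T. \<exists>s\<in>T. int N dvd t + s)"

text \<open>\<open>sym\<close> makes the first and last terms opposite, so reversing the progression
  negates it; \<open>inj\<close> keeps its \<open>k\<close> terms distinct modulo
  \<open>N\<close>.\<close>

lemma progression_symmetric_mod:
  fixes x0 \<delta> :: int
  assumes sym: "2 * x0 + \<delta> * (int k - 1) = 0" and "0 < k"
    and inj: "\<forall>i. int N dvd \<delta> * i \<longrightarrow> \<bar>i\<bar> < int k \<longrightarrow> i = 0"
  defines "T \<equiv> (\<lambda>i. x0 + \<delta> * int i) ` {..<k}"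
  shows "symmetric_mod N T" "card ((\<lambda>t. t mod int N) ` T) = k"
    "card ((\<lambda>t. t mod int N) ` nfold_sum h T) \<le> h * (k - 1) + 1"
proof -
  show "symmetric_mod N T" unfolding symmetric_mod_def
  proof
    fix t assume "t \<in> T"
    then obtain i where i: "i < k" "t = x0 + \<delta> * int i" by (auto simp: T_def)
    let ?s = "x0 + \<delta> * int (k - 1 - i)"
    have "t + ?s = 2 * x0 + \<delta> * (int k - 1)" using i by (simp add: of_nat_diff algebra_simps)
    moreover have "?s \<in> T" unfolding T_def using i by (intro imageI) simp
    ultimately show "\<exists>s\<in>T. int N dvd t + s" using sym by (metis dvd_0_right)
  qed
  have "inj_on (\<lambda>i. (x0 + \<delta> * int i) mod int N) {..<k}"
  proof (rule inj_onI)
    fix i j assume ij: "i \<in> {..<k}" "j \<in> {..<k}"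
      and "(x0 + \<delta> * int i) mod int N = (x0 + \<delta> * int j) mod int N"
    then have "int N dvd \<delta> * (int i - int j)" by (simp add: mod_eq_dvd_iff algebra_simps)
    then have "int i - int j = 0" using ij inj by auto
    then show "i = j" by simp
  qed
  then show "card ((\<lambda>t. t mod int N) ` T) = k"
    by (simp add: T_def image_image card_image)
  have "nfold_sum h T \<subseteq> (\<lambda>i. int h * x0 + \<delta> * int i) ` {..h * (k - 1)}"
    using nfold_sum_progression unfolding T_def by blast
  then have "(\<lambda>t. t mod int N) ` nfold_sum h T \<subseteq>
      (\<lambda>i. (int h * x0 + \<delta> * int i) mod int N) ` {..h * (k - 1)}" by blast
  then show "card ((\<lambda>t. t mod int N) ` nfold_sum h T) \<le> h * (k - 1) + 1"
    by (rule surj_card_le[rotated, THEN order_trans]) auto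
qed

lemma ex_symmetric_mod_small_nfold_sum:
  assumes "0 < k" "k \<le> N" "0 < h"
  shows "\<exists>T. symmetric_mod N T \<and> card ((\<lambda>t. t mod int N) ` T) = k \<and>
    card ((\<lambda>t. t mod int N) ` nfold_sum h T) \<le> h * (k - 1) + 1"
proof -
  consider "odd k" | "even k" "odd N \<or> 2 * k \<le> N" | "even k" "even N" "N < 2 * k" by linarith
  then show ?thesis
  proof cases
    case 1
    \<comment> \<open>For odd \<open>k\<close>, the interval of length \<open>k\<close> centred at
      0.\<close>
    have sym: "2 * (- ((int k - 1) div 2)) + 1 * (int k - 1) = 0" using 1 by simp
    have "i = 0" if "int N dvd 1 * i" "\<bar>i\<bar> < int k" for i
      using that assms zdvd_not_zless[of "\<bar>i\<bar>" "int N"] by force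
    then have inj: "\<forall>i. int N dvd 1 * i \<longrightarrow> \<bar>i\<bar> < int k \<longrightarrow> i = 0" by blast
    show ?thesis
      using progression_symmetric_mod[OF sym assms(1) inj] by blast
  next
    case 2
    \<comment> \<open>The progression from \<open>- (k - 1)\<close> to \<open>k - 1\<close> with
      difference 2. A collision modulo \<open>N\<close> would force \<open>N\<close> to divide
      \<open>i\<close> if \<open>N\<close> is odd; otherwise
      \<open>\<bar>2 * i\<bar> < 2 * k \<le> N\<close> excludes it.\<close>
    have sym: "2 * (- (int k - 1)) + 2 * (int k - 1) = 0" by simp
    have "i = 0" if i: "int N dvd 2 * i" "\<bar>i\<bar> < int k" for i
    proof (cases "odd N")
      case True
      then have "int N dvd i" using i by (simp add: coprime_dvd_mult_right_iff)
      then show ?thesis using i assms zdvd_not_zless[of "\<bar>i\<bar>" "int N"] by force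
    next
      case False
      then show ?thesis using i 2 zdvd_not_zless[of "\<bar>2 * i\<bar>" "int N"] by force
    qed
    then have inj: "\<forall>i. int N dvd 2 * i \<longrightarrow> \<bar>i\<bar> < int k \<longrightarrow> i = 0" by blast
    show ?thesis
      using progression_symmetric_mod[OF sym assms(1) inj] by blast
  next
    case 3
    then obtain p q where pq: "k = 2 * p" "N = 2 * q" by (auto elim!: evenE)
    have p: "1 \<le> p" "p \<le> q" using assms pq by auto
    \<comment> \<open>The interval has \<open>k - 1\<close> elements; the missing one is
      \<open>q\<close>, which is its own negative modulo \<open>N\<close> and lies outside the
      interval because \<open>p \<le> q\<close>.\<close>
    define T where "T = insert (int q) {- (int p - 1)..int p - 1}"
    have "symmetric_mod N T" unfolding symmetric_mod_def
    proof
      fix t assume "t \<in> T"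
      then consider "t = int q" | "- t \<in> T" by (auto simp: T_def)
      then show "\<exists>s\<in>T. int N dvd t + s"
      proof cases
        case 1
        then show ?thesis using pq by (intro bexI[of _ "int q"]) (auto simp: T_def)
      qed (force intro: bexI[of _ "- t"])
    qed
    moreover have cardT: "card ((\<lambda>t. t mod int N) ` T) = k"
    proof -
      have "inj_on (\<lambda>t. t mod int N) T"
      proof (rule inj_onI)
        fix s t assume "s \<in> T" "t \<in> T" "s mod int N = t mod int N"
        then have "int N dvd s - t" "\<bar>s - t\<bar> < int N"
          using p pq by (auto simp: mod_eq_dvd_iff T_def)
        then show "s = t" using zdvd_not_zless[of "\<bar>s - t\<bar>" "int N"] by force
      qed
      moreover have "card T = k" using p pq by (simp add: T_def card_insert_if)
      ultimately show ?thesis by (simp add: card_image)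
    qed
    moreover have "card ((\<lambda>t. t mod int N) ` nfold_sum h T) \<le> h * (k - 1) + 1"
    \<comment> \<open>For \<open>h = 1\<close> the sumset is \<open>T\<close> itself. For larger
      \<open>h\<close> the number \<open>N\<close> of all residues is already small enough, because
      \<open>N < 2 * k\<close>.\<close>
    proof (cases "h = 1")
      case True
      have "nfold_sum (Suc 0) T = T" by simp
      then show ?thesis using cardT True assms by simp
    next
      case False
      have "(\<lambda>t. t mod int N) ` nfold_sum h T \<subseteq> {0..<int N}" using assms by auto
      then have "card ((\<lambda>t. t mod int N) ` nfold_sum h T) \<le> N"
        using card_mono[of "{0..<int N}"] by fastforce
      also have "N \<le> 2 * (k - 1) + 1" using 3 assms by presburger
      also have "\<dots> \<le> h * (k - 1) + 1" using False assms by (intro add_mono mult_right_mono) auto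
      finally show ?thesis .
    qed
    ultimately show ?thesis by blast
  qed
qed

section \<open>Lifting from residues modulo \<open>N\<close> to residues modulo
  \<open>N * d\<close>\<close>

lemma card_mod_preimage:
  assumes "R \<subseteq> {0..<int N}"
  shows "card {x \<in> {0..<int (N * d)}. x mod int N \<in> R} = card R * d"
proof (cases "N = 0")
  case False
  have "bij_betw (\<lambda>(r, i). r + int N * i) (R \<times> {0..<int d}) {x \<in> {0..<int (N * d)}. x mod int N \<in> R}"
  proof (rule bij_betw_byWitness[where f' = "\<lambda>x. (x mod int N, x div int N)"])
    show "\<forall>p\<in>R \<times> {0..<int d}. (\<lambda>x. (x mod int N, x div int N)) (case p of (r, i) \<Rightarrow> r + int N * i) = p"
      using assms False by force
    show "(\<lambda>(r, i). r + int N * i) ` (R \<times> {0..<int d}) \<subseteq> {x \<in> {0..<int (N * d)}. x mod int N \<in> R}"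
    proof clarify
      fix r i assume ri: "r \<in> R" "i \<in> {0..<int d}"
      then have r: "0 \<le> r" "r < int N" using assms by auto
      have "int N * (i + 1) \<le> int N * int d" using ri by (intro mult_left_mono) auto
      then have "r + int N * i < int (N * d)" using r by (simp add: algebra_simps)
      moreover have "0 \<le> r + int N * i" using r ri by simp
      ultimately show "r + int N * i \<in> {0..<int (N * d)} \<and> (r + int N * i) mod int N \<in> R"
        using r ri by simp
    qed
    have "x div int N < int d" if "x < int (N * d)" for x
    proof -
      have "int N * (x div int N) \<le> x" using False by (simp add: minus_mod_eq_mult_div [symmetric])
      also have "x < int N * int d" using that by simp
      finally show ?thesis using False by simp
    qed
    then show "(\<lambda>x. (x mod int N, x div int N)) ` {x \<in> {0..<int (N * d)}. x mod int N \<in> R} \<subseteq> R \<times> {0..<int d}"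
      using False by (auto simp: pos_imp_zdiv_nonneg_iff)
    show "\<forall>x\<in>{x \<in> {0..<int (N * d)}. x mod int N \<in> R}.
        (case (x mod int N, x div int N) of (r, i) \<Rightarrow> r + int N * i) = x"
      by simp
  qed
  then show ?thesis by (simp add: bij_betw_same_card[symmetric] card_cartesian_product)
qed (use assms in auto)

lemma nfold_sum_mod_subset:
  fixes X T :: "int set"
  assumes "\<And>x. x \<in> X \<Longrightarrow> \<exists>t\<in>T. int N dvd x - t" "x \<in> nfold_sum h X"
  shows "\<exists>t\<in>nfold_sum h T. int N dvd x - t"
  using assms(2)
proof (induction h arbitrary: x)
  case (Suc h)
  then obtain a y where a: "x = a + y" "a \<in> X" "y \<in> nfold_sum h X" by (auto elim: set_plus_elim)
  then obtain s t where st: "s \<in> T" "int N dvd a - s" "t \<in> nfold_sum h T" "int N dvd y - t"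
    using Suc.IH assms(1) by blast
  have "x - (s + t) = (a - s) + (y - t)" using a by simp
  then have "int N dvd x - (s + t)" using st by (metis dvd_add)
  then show ?case using st by auto
qed simp

text \<open>\<open>B\<close> is any \<open>m\<close>-subset of the preimage of a symmetric
  \<open>T\<close>. Modulo \<open>N\<close>, both \<open>B\<close> and its negatives fall into
  \<open>T\<close>, so signed sums of \<open>B\<close> stay in the preimage of the
  \<open>h\<close>-fold sumset of \<open>T\<close>, where each residue has \<open>d\<close>
  lifts.\<close>

lemma ex_card_signed_sumset_le:
  assumes "n = N * d" "n > 0" "0 < k" "k \<le> N" "0 < h" "m \<le> k * d"
  obtains B where "B \<subseteq> carrier (integer_mod_group n)" "card B = m"
    "card (signed_sumset (integer_mod_group n) h B) \<le> (h * (k - 1) + 1) * d"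
proof -
  have N: "N > 0" using assms by auto
  obtain T where T: "symmetric_mod N T" "card ((\<lambda>t. t mod int N) ` T) = k"
    "card ((\<lambda>t. t mod int N) ` nfold_sum h T) \<le> h * (k - 1) + 1"
    using ex_symmetric_mod_small_nfold_sum[OF assms(3-5)] by blast
  define lift where "lift S = {x \<in> {0..<int (N * d)}. x mod int N \<in> (\<lambda>t. t mod int N) ` S}" for S
  have card_lift: "card (lift S) = card ((\<lambda>t. t mod int N) ` S) * d" for S
    unfolding lift_def by (rule card_mod_preimage) (use N in auto)
  have "m \<le> card (lift T)" using card_lift T assms by simp
  then obtain B where B: "B \<subseteq> lift T" "card B = m" "finite B"
    by (rule obtain_subset_with_card_n)
  have "signed_sumset (integer_mod_group n) h B \<subseteq> lift (nfold_sum h T)"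
  proof
    fix x assume "x \<in> signed_sumset (integer_mod_group n) h B"
    then obtain c where c: "(\<Sum>a\<in>B. \<bar>c a\<bar>) = int h" "x = (\<Sum>a\<in>B. c a * a) mod int n"
      by (auto simp: signed_sumset_integer_mod_group B assms(2))
    have "\<exists>t\<in>T. int N dvd y - t" if y: "y \<in> B \<union> uminus ` B" for y
    proof -
      have 1: "\<exists>t\<in>T. int N dvd y - t" if "y \<in> B" for y
        using that B(1) by (force simp: lift_def mod_eq_dvd_iff)
      show ?thesis
      proof (cases "y \<in> B")
        case False
        then obtain z where z: "z \<in> B" "y = - z" using y by auto
        obtain t s where ts: "int N dvd z - t" "s \<in> T" "int N dvd t + s"
          using 1[OF z(1)] T(1) by (auto simp: symmetric_mod_def)
        have "y - s = - ((z - t) + (t + s))" using z by simp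
        then have "int N dvd y - s" using ts by (metis dvd_add dvd_minus_iff)
        then show ?thesis using ts by blast
      qed (rule 1)
    qed
    then obtain t where t: "t \<in> nfold_sum h T" "int N dvd (\<Sum>a\<in>B. c a * a) - t"
      using nfold_sum_mod_subset[OF _ signed_combination_in_nfold_sum[OF B(3) c(1)]] by blast
    \<comment> \<open>Since \<open>N\<close> divides \<open>n\<close>, reducing modulo
      \<open>n\<close> first does not change the residue modulo \<open>N\<close>.\<close>
    have "x mod int N = t mod int N"
      using t c assms(1) by (simp add: mod_mod_cancel mod_eq_dvd_iff)
    moreover have "x \<in> {0..<int n}" using c assms(2) by simp
    ultimately show "x \<in> lift (nfold_sum h T)" using t assms(1) by (auto simp: lift_def)
  qed
  then have "card (signed_sumset (integer_mod_group n) h B) \<le> card (lift (nfold_sum h T))"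
    by (rule card_mono[rotated]) (auto simp: lift_def intro: finite_subset[of _ "{0..<int (N * d)}"])
  also have "\<dots> \<le> (h * (k - 1) + 1) * d" unfolding card_lift using T(3) by (rule mult_right_mono) simp
  finally have "card (signed_sumset (integer_mod_group n) h B) \<le> (h * (k - 1) + 1) * d" .
  moreover have "B \<subseteq> carrier (integer_mod_group n)"
    using B(1) assms(1,2) by (auto simp: carrier_integer_mod_group lift_def)
  ultimately show ?thesis using that B(2) by blast
qed

section \<open>Comparison of the two minima\<close>

theorem theorem4:
  fixes n m h :: nat
  assumes "n > 0" and "m > 0" and "h > 0" and "m \<le> n"
  shows "rho_signed (integer_mod_group n) m h = rho (integer_mod_group n) m h"
proof -
  let ?G = "integer_mod_group n"
  have carrier: "carrier ?G = {0..<int n}" using assms by (simp add: carrier_integer_mod_group)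
  then have fin: "finite A" if "A \<subseteq> carrier ?G" for A
    using that finite_subset by auto
  have signed_carrier: "signed_sumset ?G h A \<subseteq> carrier ?G" if "A \<subseteq> carrier ?G" for A
    using assms by (auto simp: signed_sumset_integer_mod_group fin[OF that] carrier)
  have le_signed: "card (sumset ?G h A) \<le> card (signed_sumset ?G h A)" if "A \<subseteq> carrier ?G" for A
    using sumset_subset_signed_sumset[OF fin[OF that] assms(1)] fin[OF signed_carrier[OF that]]
    by (intro card_mono)
  let ?P = "{A. A \<subseteq> carrier ?G \<and> card A = m}"
  have finP: "finite ?P"
    by (rule finite_subset[of _ "Pow (carrier ?G)"]) (auto simp: carrier)
  obtain A0 where "A0 \<subseteq> carrier ?G" "card A0 = m"
    using assms carrier obtain_subset_with_card_n[of m "carrier ?G"] by auto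
  then have neP: "?P \<noteq> {}" by auto
  have rho: "rho ?G m h = Min ((\<lambda>A. card (sumset ?G h A)) ` ?P)"
    unfolding rho_def by (rule arg_cong[where f = Min]) auto
  have rho_signed: "rho_signed ?G m h = Min ((\<lambda>A. card (signed_sumset ?G h A)) ` ?P)"
    unfolding rho_signed_def by (rule arg_cong[where f = Min]) auto
  show ?thesis
  proof (rule antisym)
    \<comment> \<open>A minimizer \<open>A\<close> for \<open>rho\<close> supplies \<open>d\<close>,
      \<open>k\<close> and \<open>N\<close>; the set \<open>B\<close> built from them competes in
      the minimum for \<open>rho_signed\<close>.\<close>
    have "rho ?G m h \<in> (\<lambda>A. card (sumset ?G h A)) ` ?P"
      unfolding rho using finP neP by (intro Min_in) auto
    then obtain A where A: "A \<subseteq> carrier ?G" "card A = m" "rho ?G m h = card (sumset ?G h A)"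
      by blast
    have "A \<noteq> {}" using A(2) assms(2) by auto
    then obtain d k N where dkN: "n = N * d" "0 < k" "k \<le> N" "card A \<le> k * d"
      "(h * (k - 1) + 1) * d \<le> card (sumset ?G h A)"
      using card_sumset_ge[OF A(1) _ assms(1,3)] by blast
    then obtain B where B: "B \<subseteq> carrier ?G" "card B = m"
      "card (signed_sumset ?G h B) \<le> (h * (k - 1) + 1) * d"
      using ex_card_signed_sumset_le[OF dkN(1) assms(1) dkN(2,3) assms(3), of m] A(2) by blast
    have "rho_signed ?G m h \<le> card (signed_sumset ?G h B)"
      unfolding rho_signed using B finP by (intro Min_le) auto
    then show "rho_signed ?G m h \<le> rho ?G m h"
      using B(3) dkN(5) A(3) by linarith
    \<comment> \<open>Conversely, the sumset of a minimizer \<open>C\<close> for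
      \<open>rho_signed\<close> is contained in its signed sumset.\<close>
    have "rho_signed ?G m h \<in> (\<lambda>A. card (signed_sumset ?G h A)) ` ?P"
      unfolding rho_signed using finP neP by (intro Min_in) auto
    then obtain C where C: "C \<subseteq> carrier ?G" "card C = m"
      "rho_signed ?G m h = card (signed_sumset ?G h C)"
      by blast
    have "rho ?G m h \<le> card (sumset ?G h C)"
      unfolding rho using C finP by (intro Min_le) auto
    then show "rho ?G m h \<le> rho_signed ?G m h"
      using le_signed[OF C(1)] C(3) by linarith
  qed
qed

end
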